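(* Let $n_s,n_t\ge 1$, let $\zeta=(\zeta_{ij})\in\mathbb{R}_+^{n_s\times n_t}$, $\eta>0$, and let $\mu^s\in\Sigma_{n_s}$ be a fixed probability vector. Consider the problem, in which both the transport plan $\gamma$ and the target marginal $\mu^t$ are optimized, $$\min_{\substack{\gamma\in\Pi(\mu^s,\mu^t)\\ \mu^t\in\Sigma_{n_t}}}\{\langle \zeta,\gamma\rangle_F-\eta H(\gamma)\}.$$ The dual problem of this problem reads as $$(f^\star,g^\star)=\operatorname*{arg\,min}_{f\in\mathbb{R}^{n_s},\,g\in\mathbb{R}^{n_t}}\Big\{\mathbf 1_{n_s}^\top B(f,g)\mathbf 1_{n_t}-\langle f,\mu^s\rangle+\chi_{-\mathbf 1_{n_t}}(g)\Big\},$$ where for all $g\in\mathbb{R}^{n_t}$, $\chi_{-\mathbf 1_{n_t}}(g)=0$ if $g=-\mathbf 1_{n_t}$ (i.e. $g_j=-1$ for all $j=1,\dots,n_t$) and $\chi_{-\mathbf 1_{n_t}}(g)=\infty$ otherwise.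
   Context: Notation. $\mathbf 1_n\in\mathbb{R}^n$ is the all-ones vector. $\Sigma_n=\{\omega\in\mathbb{R}^n_+:\sum_{j=1}^n\omega_j=1\}$ is the probability simplex. For $\mu\in\mathbb{R}_+^{n_s}$ and $\mu'\in\mathbb{R}_+^{n_t}$, $\Pi(\mu,\mu')=\{\gamma\in\mathbb{R}_+^{n_s\times n_t}:\gamma\mathbf 1_{n_t}=\mu,\ \gamma^\top\mathbf 1_{n_s}=\mu'\}$. $\langle T,W\rangle_F=\sum_{i,j}T_{ij}W_{ij}$ is the Frobenius product. $H(\gamma)=-\sum_{i=1}^{n_s}\sum_{j=1}^{n_t}\gamma_{ij}\log\gamma_{ij}$ (with $0\log 0=0$). $K=e^{-\zeta/\eta}$ is the entrywise exponential, i.e. $K_{ij}=e^{-\zeta_{ij}/\eta}$, and $B(f,g)=\mathrm{diag}(e^{f})\,K\,\mathrm{diag}(e^{g})$, i.e. $B(f,g)_{ij}=e^{f_i}K_{ij}e^{g_j}$. Meaning of "dual problem". It is the Lagrangian dual of the primal problem with respect to the constraints $\gamma\mathbf 1_{n_t}=\mu^s$ (multiplier $\lambda\in\mathbb{R}^{n_s}$), $\gamma^\top\mathbf 1_{n_s}=\mu^t$ (multiplier $\beta\in\mathbb{R}^{n_t}$), $\mu^t\ge 0$ and $\sum_j\mu^t_j=1$. It is written in variables $f,g$ that are, up to opposite shifts by a common constant, $-\lambda/\eta-\tfrac12\mathbf 1_{n_s}$ and $-\beta/\eta-\tfrac12\mathbf 1_{n_t}$. The Lagrangian dual maximization problem is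 written as a minimization by dropping the overall factor $-\eta$: the dual objective to be maximized is $-\eta$ times the displayed objective, so the optimal value of the Lagrangian dual is $-\eta$ times the infimum of the displayed objective. *)

theory Defs
  imports "HOL-Analysis.Analysis"
begin

text \<open>
  Lagrangian duality for minimising \<open>F\<close> over the \<open>x \<in> X\<close> with \<open>h x = 0\<close> and \<open>k x \<le> 0\<close>; the constraint
  \<open>x \<in> X\<close> is kept implicit. The order on \<^class>\<open>ordered_euclidean_space\<close> is componentwise, so
  \<open>0 \<le> v\<close> is the usual sign condition on inequality multipliers. The dual problem is to maximise
  \<open>dual_function\<close> over all \<open>(u, v)\<close> with \<open>0 \<le> v\<close>.
\<close>

definition feasible_set ::
  "'x set \<Rightarrow> ('x \<Rightarrow> 'e::euclidean_space) \<Rightarrow> ('x \<Rightarrow> 'k::ordered_euclidean_space) \<Rightarrow> 'x set" where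
  "feasible_set X h k = {x \<in> X. h x = 0 \<and> k x \<le> 0}"

definition lagrangian ::
  "('x \<Rightarrow> real) \<Rightarrow> ('x \<Rightarrow> 'e::euclidean_space) \<Rightarrow> ('x \<Rightarrow> 'k::ordered_euclidean_space) \<Rightarrow>
    'x \<Rightarrow> 'e \<Rightarrow> 'k \<Rightarrow> real" where
  "lagrangian F h k x u v = F x + u \<bullet> h x + v \<bullet> k x"

definition dual_function ::
  "'x set \<Rightarrow> ('x \<Rightarrow> real) \<Rightarrow> ('x \<Rightarrow> 'e::euclidean_space) \<Rightarrow> ('x \<Rightarrow> 'k::ordered_euclidean_space) \<Rightarrow>
    'e \<Rightarrow> 'k \<Rightarrow> ereal" where
  "dual_function X F h k u v = (INF x\<in>X. ereal (lagrangian F h k x u v))"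


text \<open>
  On vectors, \<open>1\<close> is the all-ones vector and \<open>vec c\<close> the constant vector; on matrices, \<open>\<bullet>\<close> is the
  Frobenius product. A matrix with rows indexed by \<open>'s\<close> and columns by \<open>'t\<close> has type
  \<open>real ^ 't ^ 's\<close>.
\<close>

definition prob_simplex :: "(real ^ 'n) set" where
  "prob_simplex = {\<omega>. (\<forall>j. 0 \<le> \<omega> $ j) \<and> (\<Sum>j\<in>UNIV. \<omega> $ j) = 1}"

definition nonneg_matrices :: "(real ^ 't ^ 's) set" where
  "nonneg_matrices = {\<gamma>. \<forall>i j. 0 \<le> \<gamma> $ i $ j}"

definition couplings :: "real ^ 's \<Rightarrow> real ^ 't \<Rightarrow> (real ^ 't ^ 's) set" where
  "couplings \<mu> \<mu>' = {\<gamma> \<in> nonneg_matrices. \<gamma> *v 1 = \<mu> \<and> transpose \<gamma> *v 1 = \<mu>'}"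

text \<open>Since \<open>ln 0 = 0\<close>, the convention \<open>0 log 0 = 0\<close> holds.\<close>

definition entropy :: "real ^ 't ^ 's \<Rightarrow> real" where
  "entropy \<gamma> = - (\<Sum>i\<in>UNIV. \<Sum>j\<in>UNIV. \<gamma> $ i $ j * ln (\<gamma> $ i $ j))"


text \<open>The primal problem is to minimise \<open>ot_objective \<zeta> \<eta>\<close> over \<open>ot_feasible \<mu>s\<close>.\<close>

definition ot_objective :: "real ^ 't ^ 's \<Rightarrow> real \<Rightarrow> (real ^ 't ^ 's) \<times> (real ^ 't) \<Rightarrow> real" where
  "ot_objective \<zeta> \<eta> = (\<lambda>(\<gamma>, \<mu>t). \<zeta> \<bullet> \<gamma> - \<eta> * entropy \<gamma>)"

definition ot_feasible :: "real ^ 's \<Rightarrow> ((real ^ 't ^ 's) \<times> (real ^ 't)) set" where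
  "ot_feasible \<mu>s = {(\<gamma>, \<mu>t). \<mu>t \<in> prob_simplex \<and> \<gamma> \<in> couplings \<mu>s \<mu>t}"

text \<open>
  All constraints are dualised except \<open>\<gamma> \<ge> 0\<close>, which is the domain of the entropy.
\<close>

definition ot_domain :: "((real ^ 't ^ 's) \<times> (real ^ 't)) set" where
  "ot_domain = nonneg_matrices \<times> UNIV"

definition ot_eq ::
  "real ^ 's \<Rightarrow> (real ^ 't ^ 's) \<times> (real ^ 't) \<Rightarrow> (real ^ 's) \<times> (real ^ 't) \<times> real" where
  "ot_eq \<mu>s = (\<lambda>(\<gamma>, \<mu>t).
     (\<gamma> *v 1 - \<mu>s, transpose \<gamma> *v 1 - \<mu>t, (\<Sum>j\<in>UNIV. \<mu>t $ j) - 1))"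

definition ot_ineq :: "(real ^ 't ^ 's) \<times> (real ^ 't) \<Rightarrow> real ^ 't" where
  "ot_ineq = (\<lambda>(\<gamma>, \<mu>t). - \<mu>t)"

lemma feasible_set_eq_ot_feasible:
  "feasible_set ot_domain (ot_eq \<mu>s) ot_ineq = ot_feasible \<mu>s"
  by (auto simp: feasible_set_def ot_domain_def ot_eq_def ot_ineq_def ot_feasible_def
      couplings_def prob_simplex_def less_eq_vec_def zero_prod_def)

definition ot_dual ::
  "real ^ 't ^ 's \<Rightarrow> real \<Rightarrow> real ^ 's \<Rightarrow> (real ^ 's) \<times> (real ^ 't) \<times> real \<Rightarrow> real ^ 't \<Rightarrow> ereal" where
  "ot_dual \<zeta> \<eta> \<mu>s = dual_function ot_domain (ot_objective \<zeta> \<eta>) (ot_eq \<mu>s) ot_ineq"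


definition gibbs_kernel :: "real ^ 't ^ 's \<Rightarrow> real \<Rightarrow> real ^ 't ^ 's" where
  "gibbs_kernel \<zeta> \<eta> = (\<chi> i j. exp (- \<zeta> $ i $ j / \<eta>))"

definition scaled_kernel ::
  "real ^ 't ^ 's \<Rightarrow> real \<Rightarrow> real ^ 's \<Rightarrow> real ^ 't \<Rightarrow> real ^ 't ^ 's" where
  "scaled_kernel \<zeta> \<eta> f g = (\<chi> i j. exp (f $ i) * gibbs_kernel \<zeta> \<eta> $ i $ j * exp (g $ j))"

definition char_minus_one :: "real ^ 't \<Rightarrow> ereal" where
  "char_minus_one g = (if g = - 1 then 0 else \<infinity>)"

definition fg_objective ::
  "real ^ 't ^ 's \<Rightarrow> real \<Rightarrow> real ^ 's \<Rightarrow> (real ^ 's) \<times> (real ^ 't) \<Rightarrow> ereal" where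
  "fg_objective \<zeta> \<eta> \<mu>s = (\<lambda>(f, g).
     ereal (1 \<bullet> (scaled_kernel \<zeta> \<eta> f g *v 1) - f \<bullet> \<mu>s) + char_minus_one g)"

text \<open>
  Setting the \<open>\<gamma>\<close>-derivative of the Lagrangian to zero gives
  \<open>\<gamma>\<^sub>i\<^sub>j = exp (- (\<zeta>\<^sub>i\<^sub>j + \<lambda>\<^sub>i + \<beta>\<^sub>j) / \<eta> - 1)\<close>, which is the scaled kernel in the variables below for every \<open>c\<close>.
\<close>

definition fg_of_multipliers ::
  "real \<Rightarrow> real \<Rightarrow> real ^ 's \<Rightarrow> real ^ 't \<Rightarrow> (real ^ 's) \<times> (real ^ 't)" where
  "fg_of_multipliers \<eta> c lam \<beta> =
     (- (lam /\<^sub>R \<eta>) - vec (1/2) + vec c, - (\<beta> /\<^sub>R \<eta>) - vec (1/2) - vec c)"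

end

theory Submission
  imports Defs
begin

text \<open>
  The Lagrangian is affine in the target marginal, so its infimum is \<open>-\<infinity>\<close> unless \<open>\<beta> + \<nu> = vec \<theta>\<close>.
  Minimising over each entry of \<open>\<gamma>\<close> separately then gives the exponential term. This value
  increases strictly when \<open>\<beta>\<close> is raised to \<open>vec \<theta>\<close>, so \<open>\<nu> = 0\<close> at the optimum and \<open>\<beta>\<close> is
  constant; the opposite shifts by \<open>c\<close> normalise this constant to \<open>g = -1\<close>.
\<close>

text \<open>Fenchel-Young inequality for \<open>x * ln x\<close>: the right side is convex in
  \<open>x\<close>, with minimiser \<open>y = exp (- a / \<eta> - 1)\<close> and minimum
  \<open>- \<eta> * y\<close>. Writing \<open>a\<close> through \<open>ln y\<close> reduces the
  claim to \<open>ln t \<le> t - 1\<close> at \<open>t = y / x\<close>, which needs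
  \<open>x > 0\<close>; hence the case split.\<close>

lemma entropy_conjugate_ge:
  fixes x a \<eta> :: real
  assumes "0 < \<eta>" "0 \<le> x"
  shows "- \<eta> * exp (- a / \<eta> - 1) \<le> x * a + \<eta> * (x * ln x)"
proof (cases "x = 0")
  case True
  then show ?thesis using assms by simp
next
  case False
  define y where "y = exp (- a / \<eta> - 1)"
  have x: "0 < x" and y: "0 < y" using False assms by (auto simp: y_def)
  have a: "a = - \<eta> * (ln y + 1)" using assms by (simp add: y_def field_simps)
  have "ln (y / x) \<le> y / x - 1" using x y by (intro ln_le_minus_one) simp
  then have "x * ln (y / x) \<le> x * (y / x - 1)" using x by (intro mult_left_mono) auto
  then have "x * (ln y - ln x) \<le> y - x" using x y by (simp add: ln_div right_diff_distrib)
  then have "\<eta> * (x * (ln y - ln x)) \<le> \<eta> * (y - x)" using assms by (intro mult_left_mono) auto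
  then have "- \<eta> * y \<le> x * (- \<eta> * (ln y + 1)) + \<eta> * (x * ln x)"
    by (simp add: algebra_simps)
  then show ?thesis unfolding y_def [symmetric] a [symmetric] .
qed

section \<open>Closed form of the Lagrangian and of the dual function\<close>

lemma inner_matrix: "(A :: real ^ 't ^ 's) \<bullet> B = (\<Sum>i\<in>UNIV. \<Sum>j\<in>UNIV. A $ i $ j * B $ i $ j)"
  by (simp add: inner_vec_def)

lemma inner_matrix_vector_one:
  fixes A :: "real ^ 't ^ 's"
  shows "v \<bullet> (A *v 1) = (\<Sum>i\<in>UNIV. \<Sum>j\<in>UNIV. A $ i $ j * v $ i)"
  by (simp add: inner_vec_def matrix_vector_mult_def sum_distrib_left mult.commute)

lemma inner_transpose_vector_one:
  fixes A :: "real ^ 't ^ 's"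
  shows "w \<bullet> (transpose A *v 1) = (\<Sum>i\<in>UNIV. \<Sum>j\<in>UNIV. A $ i $ j * w $ j)"
  unfolding inner_matrix_vector_one by (subst sum.swap) (simp add: transpose_def)

text \<open>Terms are collected by primal variable: the plan enters entry by entry, the target
  marginal only linearly, so the two minimisations decouple.\<close>

lemma lagrangian_ot_eq:
  "lagrangian (ot_objective \<zeta> \<eta>) (ot_eq \<mu>s) ot_ineq (\<gamma>, \<mu>t) (lam, \<beta>, \<theta>) \<nu>
     = (\<Sum>i\<in>UNIV. \<Sum>j\<in>UNIV. \<gamma> $ i $ j * (\<zeta> $ i $ j + lam $ i + \<beta> $ j)
           + \<eta> * (\<gamma> $ i $ j * ln (\<gamma> $ i $ j)))
       + (vec \<theta> - \<beta> - \<nu>) \<bullet> \<mu>t - lam \<bullet> \<mu>s - \<theta>"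
proof -
  have 1: "vec \<theta> \<bullet> \<mu>t = \<theta> * (\<Sum>j\<in>UNIV. \<mu>t $ j)"
    by (simp add: inner_vec_def sum_distrib_left)
  have 2: "(\<Sum>i\<in>UNIV. \<Sum>j\<in>UNIV. \<gamma> $ i $ j * (\<zeta> $ i $ j + lam $ i + \<beta> $ j)
           + \<eta> * (\<gamma> $ i $ j * ln (\<gamma> $ i $ j)))
      = \<zeta> \<bullet> \<gamma> + lam \<bullet> (\<gamma> *v 1) + \<beta> \<bullet> (transpose \<gamma> *v 1) - \<eta> * entropy \<gamma>"
    unfolding inner_transpose_vector_one inner_matrix_vector_one [of lam] inner_matrix entropy_def
    by (simp add: sum.distrib sum_distrib_left distrib_left mult.commute)
  show ?thesis
    unfolding lagrangian_def ot_objective_def ot_eq_def ot_ineq_def 2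
    by (simp add: inner_diff 1 right_diff_distrib
        del: transpose_matrix_vector)
qed

text \<open>The dual function where it is finite. \<open>\<nu>\<close> is absent because it enters
  only through the condition \<open>\<beta> + \<nu> = vec \<theta>\<close>.\<close>

definition dual_value ::
  "real ^ 't ^ 's \<Rightarrow> real \<Rightarrow> real ^ 's \<Rightarrow> real ^ 's \<Rightarrow> real ^ 't \<Rightarrow> real \<Rightarrow> real" where
  "dual_value \<zeta> \<eta> \<mu>s lam \<beta> \<theta> =
     - \<eta> * (\<Sum>i\<in>UNIV. \<Sum>j\<in>UNIV. exp (- (\<zeta> $ i $ j + lam $ i + \<beta> $ j) / \<eta> - 1)) - lam \<bullet> \<mu>s - \<theta>"

lemma ot_dual_eq:
  fixes \<zeta> :: "real ^ 't ^ 's"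
  assumes "0 < \<eta>"
  shows "ot_dual \<zeta> \<eta> \<mu>s (lam, \<beta>, \<theta>) \<nu>
    = (if \<beta> + \<nu> = vec \<theta> then ereal (dual_value \<zeta> \<eta> \<mu>s lam \<beta> \<theta>) else - \<infinity>)"
proof -
  define L where "L x = lagrangian (ot_objective \<zeta> \<eta>) (ot_eq \<mu>s) ot_ineq x (lam, \<beta>, \<theta>) \<nu>" for x
  \<comment> \<open>The stationary plan: each entry is the minimiser in
    \<open>entropy_conjugate_ge\<close> for
    \<open>a = \<zeta> $ i $ j + lam $ i + \<beta> $ j\<close>.\<close>
  define G :: "real ^ 't ^ 's" where
    "G = (\<chi> i j. exp (- (\<zeta> $ i $ j + lam $ i + \<beta> $ j) / \<eta> - 1))"
  define q where "q = vec \<theta> - \<beta> - \<nu>"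
  have dual: "ot_dual \<zeta> \<eta> \<mu>s (lam, \<beta>, \<theta>) \<nu> = (INF x\<in>ot_domain. ereal (L x))"
    by (simp add: ot_dual_def dual_function_def L_def)
  have G: "(G, \<mu>t) \<in> ot_domain" for \<mu>t
    by (simp add: ot_domain_def nonneg_matrices_def G_def)
  have LG: "L (G, \<mu>t) = dual_value \<zeta> \<eta> \<mu>s lam \<beta> \<theta> + q \<bullet> \<mu>t" for \<mu>t
  proof -
    \<comment> \<open>Equality case of \<open>entropy_conjugate_ge\<close>.\<close>
    have "G $ i $ j * (\<zeta> $ i $ j + lam $ i + \<beta> $ j) + \<eta> * (G $ i $ j * ln (G $ i $ j))
      = - \<eta> * exp (- (\<zeta> $ i $ j + lam $ i + \<beta> $ j) / \<eta> - 1)" for i j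
      using assms by (simp add: G_def field_simps)
    then show ?thesis
      unfolding L_def lagrangian_ot_eq dual_value_def q_def by (simp add: sum_distrib_left)
  qed
  show ?thesis
  proof (cases "\<beta> + \<nu> = vec \<theta>")
    case True
    then have q: "q = 0" by (simp add: q_def algebra_simps flip: True)
    have "dual_value \<zeta> \<eta> \<mu>s lam \<beta> \<theta> \<le> L x" if "x \<in> ot_domain" for x
    proof -
      obtain \<gamma> \<mu>t where x: "x = (\<gamma>, \<mu>t)" by (cases x)
      have "0 \<le> \<gamma> $ i $ j" for i j
        using that by (simp add: x ot_domain_def nonneg_matrices_def)
      then have "(\<Sum>i\<in>UNIV. \<Sum>j\<in>UNIV. - \<eta> * exp (- (\<zeta> $ i $ j + lam $ i + \<beta> $ j) / \<eta> - 1))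
        \<le> (\<Sum>i\<in>UNIV. \<Sum>j\<in>UNIV. \<gamma> $ i $ j * (\<zeta> $ i $ j + lam $ i + \<beta> $ j)
           + \<eta> * (\<gamma> $ i $ j * ln (\<gamma> $ i $ j)))"
        by (intro sum_mono entropy_conjugate_ge assms)
      then show ?thesis
        unfolding L_def x lagrangian_ot_eq q_def [symmetric] q dual_value_def
        by (simp add: sum_distrib_left)
    qed
    moreover have "L (G, 0) = dual_value \<zeta> \<eta> \<mu>s lam \<beta> \<theta>" by (simp add: LG)
    ultimately have "(INF x\<in>ot_domain. ereal (L x)) = ereal (dual_value \<zeta> \<eta> \<mu>s lam \<beta> \<theta>)"
      by (intro antisym INF_greatest INF_lower2 [OF G [of 0]]) auto
    then show ?thesis using True by (simp add: dual)
  next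
    case False
    then have "q \<noteq> 0" by (auto simp: q_def algebra_simps)
    then have q: "q \<bullet> q \<noteq> 0" by simp
    have "(INF x\<in>ot_domain. ereal (L x)) \<le> ereal r" for r
    proof -
      \<comment> \<open>The marginal is unrestricted in \<open>ot_domain\<close>, so it can move
        along \<open>q\<close>; this multiple makes the Lagrangian equal to \<open>r\<close>
        exactly.\<close>
      have "L (G, ((r - dual_value \<zeta> \<eta> \<mu>s lam \<beta> \<theta>) / (q \<bullet> q)) *\<^sub>R q) = r"
        using q by (simp add: LG del: inner_eq_zero_iff)
      then show ?thesis by (intro INF_lower2 [OF G]) (rule eq_refl, simp)
    qed
    then have "(INF x\<in>ot_domain. ereal (L x)) = - \<infinity>" by (rule ereal_bot)
    then show ?thesis using False by (simp add: dual)
  qed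
qed

section \<open>Change of variables from multipliers to \<open>(f, g)\<close>\<close>

lemma fg_objective_multipliers:
  fixes \<zeta> :: "real ^ 't ^ 's"
  assumes "0 < \<eta>" "\<mu>s \<in> prob_simplex"
  shows "fg_objective \<zeta> \<eta> \<mu>s (fg_of_multipliers \<eta> c lam \<beta>)
    = (if \<beta> = vec (\<eta> * (1/2 - c))
       then ereal (- dual_value \<zeta> \<eta> \<mu>s lam \<beta> (\<eta> * (1/2 - c)) / \<eta>) else \<infinity>)"
proof -
  define f where "f = fst (fg_of_multipliers \<eta> c lam \<beta>)"
  define g where "g = snd (fg_of_multipliers \<eta> c lam \<beta>)"
  have fg: "fg_of_multipliers \<eta> c lam \<beta> = (f, g)" by (simp add: f_def g_def)
  have fi: "f $ i = - (lam $ i / \<eta>) - 1/2 + c" for i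
    using assms(1) by (simp add: f_def fg_of_multipliers_def field_simps)
  have gj: "g $ j = - (\<beta> $ j / \<eta>) - 1/2 - c" for j
    using assms(1) by (simp add: g_def fg_of_multipliers_def field_simps)
  have g1: "g = - 1 \<longleftrightarrow> \<beta> = vec (\<eta> * (1/2 - c))"
    using assms(1) by (simp add: vec_eq_iff gj field_simps) metis
  \<comment> \<open>The opposite shifts by \<open>c\<close> cancel, and the two halves add up to the
    \<open>- 1\<close> in the exponent.\<close>
  have "scaled_kernel \<zeta> \<eta> f g $ i $ j = exp (- (\<zeta> $ i $ j + lam $ i + \<beta> $ j) / \<eta> - 1)" for i j
    using assms(1)
    by (simp add: scaled_kernel_def gibbs_kernel_def fi gj add_divide_distrib diff_divide_distrib
        flip: exp_add)
  then have K: "1 \<bullet> (scaled_kernel \<zeta> \<eta> f g *v 1)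
      = (\<Sum>i\<in>UNIV. \<Sum>j\<in>UNIV. exp (- (\<zeta> $ i $ j + lam $ i + \<beta> $ j) / \<eta> - 1))"
    by (simp add: inner_matrix_vector_one)
  have "f = (- 1 / \<eta>) *\<^sub>R lam + vec (c - 1/2)"
    by (simp add: vec_eq_iff fi)
  \<comment> \<open>Since \<open>\<mu>s\<close> has total mass one, the shift leaves the constant
    \<open>c - 1/2\<close>, which supplies the \<open>\<theta>\<close> term of
    \<open>dual_value\<close> at \<open>\<theta> = \<eta> * (1/2 - c)\<close>.\<close>
  moreover have "vec (c - 1/2) \<bullet> \<mu>s = c - 1/2"
    using assms(2) by (simp add: inner_vec_def prob_simplex_def flip: sum_distrib_left)
  ultimately have F: "f \<bullet> \<mu>s = - (lam \<bullet> \<mu>s) / \<eta> + (c - 1/2)"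
    by (simp add: inner_diff_left)
  have "1 \<bullet> (scaled_kernel \<zeta> \<eta> f g *v 1) - f \<bullet> \<mu>s
      = - dual_value \<zeta> \<eta> \<mu>s lam \<beta> (\<eta> * (1/2 - c)) / \<eta>"
    unfolding dual_value_def K [symmetric] F using assms(1)
    by (simp add: diff_divide_distrib add_divide_distrib)
  then show ?thesis by (simp add: fg fg_objective_def char_minus_one_def g1)
qed

lemma fg_of_multipliers_surj:
  assumes "0 < \<eta>"
  shows "\<exists>lam \<beta>. fg = fg_of_multipliers \<eta> c lam \<beta>"
proof (intro exI)
  show "fg = fg_of_multipliers \<eta> c (- \<eta> *\<^sub>R (fst fg + vec (1/2) - vec c))
    (- \<eta> *\<^sub>R (snd fg + vec (1/2) + vec c))"
    using assms by (cases fg) (simp add: fg_of_multipliers_def)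
qed

section \<open>Reduction to constant multipliers\<close>

lemma dual_value_less:
  fixes \<zeta> :: "real ^ 't ^ 's"
  assumes "0 < \<eta>" "\<beta> + \<nu> = vec \<theta>" "0 \<le> \<nu>" "\<beta> \<noteq> vec \<theta>"
  shows "dual_value \<zeta> \<eta> \<mu>s lam \<beta> \<theta> < dual_value \<zeta> \<eta> \<mu>s lam (vec \<theta>) \<theta>"
proof -
  have "\<beta> $ j + \<nu> $ j = \<theta>" "0 \<le> \<nu> $ j" for j
    using assms(2,3) by (auto simp: vec_eq_iff less_eq_vec_def)
  then have le: "\<beta> $ j \<le> \<theta>" for j by (metis le_add_same_cancel1)
  obtain k where "\<beta> $ k \<noteq> \<theta>" using assms(4) by (auto simp: vec_eq_iff)
  with le have k: "\<beta> $ k < \<theta>" by (simp add: less_le)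
  let ?e = "\<lambda>b i j. exp (- (\<zeta> $ i $ j + lam $ i + b) / \<eta> - 1)"
  \<comment> \<open>One column \<open>k\<close> with a strict gap suffices, since it meets every
    row.\<close>
  have row: "(\<Sum>j\<in>UNIV. ?e \<theta> i j) < (\<Sum>j\<in>UNIV. ?e (\<beta> $ j) i j)" for i
  proof (rule sum_strict_mono_ex1)
    show "\<forall>j\<in>UNIV. ?e \<theta> i j \<le> ?e (\<beta> $ j) i j"
      using assms(1) le by (simp add: divide_right_mono)
    show "\<exists>j\<in>UNIV. ?e \<theta> i j < ?e (\<beta> $ j) i j"
      using assms(1) k by (intro bexI [of _ k]) (simp_all add: divide_strict_right_mono)
  qed simp
  have "(\<Sum>i\<in>UNIV. \<Sum>j\<in>UNIV. ?e \<theta> i j) < (\<Sum>i\<in>UNIV. \<Sum>j\<in>UNIV. ?e (\<beta> $ j) i j)"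
    by (rule sum_strict_mono) (use row in auto)
  then show ?thesis using assms(1) by (simp add: dual_value_def)
qed

lemma dual_value_le:
  assumes "0 < \<eta>" "\<beta> + \<nu> = vec \<theta>" "0 \<le> \<nu>"
  shows "dual_value \<zeta> \<eta> \<mu>s lam \<beta> \<theta> \<le> dual_value \<zeta> \<eta> \<mu>s lam (vec \<theta>) \<theta>"
  using dual_value_less [OF assms] by (cases "\<beta> = vec \<theta>") (auto intro: less_imp_le)

text \<open>The shift \<open>1/2 - \<theta> / \<eta>\<close> solves
  \<open>\<theta> = \<eta> * (1/2 - c)\<close> for \<open>c\<close>, so the constant multiplier is
  sent to \<open>g = - 1\<close>.\<close>

lemma fg_objective_constant_multiplier:
  assumes "0 < \<eta>" "\<mu>s \<in> prob_simplex"
  shows "fg_objective \<zeta> \<eta> \<mu>s (fg_of_multipliers \<eta> (1/2 - \<theta> / \<eta>) lam (vec \<theta>))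
    = ereal (- dual_value \<zeta> \<eta> \<mu>s lam (vec \<theta>) \<theta> / \<eta>)"
  using assms by (simp add: fg_objective_multipliers)

text \<open>Reduces comparisons with arbitrary \<open>(f, g)\<close> to dual values at constant
  multipliers. The change of variables is onto for each \<open>c\<close>, so \<open>c = 0\<close>
  serves.\<close>

lemma fg_objective_cases:
  assumes "0 < \<eta>" "\<mu>s \<in> prob_simplex"
  obtains "fg_objective \<zeta> \<eta> \<mu>s fg = \<infinity>"
  | lam \<theta> where "fg_objective \<zeta> \<eta> \<mu>s fg = ereal (- dual_value \<zeta> \<eta> \<mu>s lam (vec \<theta>) \<theta> / \<eta>)"
proof -
  obtain lam \<beta> where "fg = fg_of_multipliers \<eta> 0 lam \<beta>"
    using fg_of_multipliers_surj [OF assms(1)] by blast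
  then show thesis
    using that fg_objective_multipliers [OF assms, of \<zeta> 0 lam \<beta>] by (metis (full_types))
qed

text \<open>The factor splits into scaling by \<open>\<eta> > 0\<close>, which commutes with
  suprema, and negation, which exchanges infimum and supremum.\<close>

lemma ereal_uminus_mult_INF:
  fixes f :: "'a \<Rightarrow> ereal"
  assumes "0 < \<eta>"
  shows "- ereal \<eta> * (INF x. f x) = (SUP x. - ereal \<eta> * f x)"
proof -
  have "(SUP x. - ereal \<eta> * f x) = (SUP x. ereal \<eta> * - f x)"
    by (simp only: ereal_mult_minus_left ereal_mult_minus_right)
  also have "\<dots> = ereal \<eta> * (SUP x. - f x)"
    using assms by (intro Sup_ereal_mult_left' [symmetric]) auto
  finally show ?thesis
    by (simp only: ereal_SUP_uminus_eq ereal_mult_minus_left ereal_mult_minus_right)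
qed

section \<open>Equality of optimal values and correspondence of optimisers\<close>

theorem lemma1:
  fixes \<zeta> :: "real ^ 't ^ 's" and \<eta> :: real and \<mu>s :: "real ^ 's"
  assumes "\<forall>i j. 0 \<le> \<zeta> $ i $ j"
    and "0 < \<eta>"
    and "\<mu>s \<in> prob_simplex"
  shows
    "(\<forall>lam \<beta> c. snd (fg_of_multipliers \<eta> c lam \<beta>) = - 1 \<longrightarrow>
        (SUP (\<theta>, \<nu>) \<in> {(\<theta>, \<nu>). 0 \<le> \<nu>}. ot_dual \<zeta> \<eta> \<mu>s (lam, \<beta>, \<theta>) \<nu>)
          = - ereal \<eta> * fg_objective \<zeta> \<eta> \<mu>s (fg_of_multipliers \<eta> c lam \<beta>))
     \<and> (SUP (u, \<nu>) \<in> {(u, \<nu>). 0 \<le> \<nu>}. ot_dual \<zeta> \<eta> \<mu>s u \<nu>)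
          = - ereal \<eta> * (INF fg. fg_objective \<zeta> \<eta> \<mu>s fg)
     \<and> (\<forall>lam \<beta>.
          (\<exists>\<theta> \<nu>. is_arg_max (\<lambda>(u, \<nu>). ot_dual \<zeta> \<eta> \<mu>s u \<nu>) (\<lambda>(u, \<nu>). 0 \<le> \<nu>) ((lam, \<beta>, \<theta>), \<nu>))
          \<longleftrightarrow> (\<exists>c. is_arg_min (fg_objective \<zeta> \<eta> \<mu>s) (\<lambda>_. True) (fg_of_multipliers \<eta> c lam \<beta>)))"
proof -
  note \<eta> = assms(2) and \<mu> = assms(3)
  let ?D = "ot_dual \<zeta> \<eta> \<mu>s" and ?P = "fg_objective \<zeta> \<eta> \<mu>s" and ?V = "dual_value \<zeta> \<eta> \<mu>s"
  have D0: "?D (lam, vec \<theta>, \<theta>) 0 = ereal (?V lam (vec \<theta>) \<theta>)" for lam \<theta>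
    by (simp add: ot_dual_eq [OF \<eta>])

  have partial: "(SUP (\<theta>, \<nu>) \<in> {(\<theta>, \<nu>). 0 \<le> \<nu>}. ?D (lam, \<beta>, \<theta>) \<nu>)
      = - ereal \<eta> * ?P (fg_of_multipliers \<eta> c lam \<beta>)"
    if "snd (fg_of_multipliers \<eta> c lam \<beta>) = - 1" for lam \<beta> c
  proof -
    define b where "b = \<eta> * (1/2 - c)"
    have \<beta>: "\<beta> = vec b"
      using that \<eta> by (simp add: b_def fg_of_multipliers_def vec_eq_iff field_simps)
    have R: "- ereal \<eta> * ?P (fg_of_multipliers \<eta> c lam \<beta>) = ereal (?V lam (vec b) b)"
      using \<eta> by (simp add: fg_objective_multipliers [OF \<eta> \<mu>] \<beta> b_def)
    \<comment> \<open>For fixed \<open>lam\<close> and \<open>\<beta> = vec b\<close>, finiteness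
      and \<open>0 \<le> \<nu>\<close> force \<open>b \<le> \<theta>\<close>. The value depends on
      \<open>\<theta>\<close> only through \<open>- \<theta>\<close>, so \<open>\<theta> = b\<close>
      with \<open>\<nu> = 0\<close> is best.\<close>
    have "?D (lam, \<beta>, \<theta>) \<nu> \<le> ereal (?V lam (vec b) b)" if "0 \<le> \<nu>" for \<theta> \<nu>
    proof (cases "\<beta> + \<nu> = vec \<theta>")
      case True
      then have "b + \<nu> $ j = \<theta>" "0 \<le> \<nu> $ j" for j
        using that by (auto simp: \<beta> vec_eq_iff less_eq_vec_def)
      then have "b \<le> \<theta>" by (metis le_add_same_cancel1)
      then show ?thesis using True by (simp add: ot_dual_eq [OF \<eta>] \<beta> dual_value_def)
    qed (simp add: ot_dual_eq [OF \<eta>])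
    then show ?thesis
      unfolding R by (intro antisym SUP_least SUP_upper2 [of "(b, 0)"]) (auto simp: D0 \<beta>)
  qed

  \<comment> \<open>If the dual function is \<open>- \<infinity>\<close> any \<open>\<theta>\<close>
    works; otherwise \<open>\<beta>\<close> is raised to \<open>vec \<theta>\<close>.\<close>
  have D_le: "\<exists>\<theta>. ?D u \<nu> \<le> ereal (?V (fst u) (vec \<theta>) \<theta>)" if "0 \<le> \<nu>" for u \<nu>
    using that by (cases u) (auto simp: ot_dual_eq [OF \<eta>] intro!: dual_value_le [OF \<eta>])

  \<comment> \<open>Constant multipliers with \<open>\<nu> = 0\<close> mediate: they dominate every
    feasible multiplier, and they account for every \<open>(f, g)\<close> with finite
    objective.\<close>
  have "(SUP (u, \<nu>) \<in> {(u, \<nu>). 0 \<le> \<nu>}. ?D u \<nu>) = (SUP fg. - ereal \<eta> * ?P fg)"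
  proof (intro antisym SUP_least)
    fix p :: "((real ^ 's) \<times> (real ^ 't) \<times> real) \<times> (real ^ 't)"
    assume "p \<in> {(u, \<nu>). 0 \<le> \<nu>}"
    then obtain u \<nu> where p: "p = (u, \<nu>)" "0 \<le> \<nu>" by auto
    obtain \<theta> where "?D u \<nu> \<le> ereal (?V (fst u) (vec \<theta>) \<theta>)"
      using D_le [OF p(2)] by blast
    then show "(case p of (u, \<nu>) \<Rightarrow> ?D u \<nu>) \<le> (SUP fg. - ereal \<eta> * ?P fg)"
      using \<eta> by (intro SUP_upper2 [of "fg_of_multipliers \<eta> (1/2 - \<theta> / \<eta>) (fst u) (vec \<theta>)"])
        (auto simp: p fg_objective_constant_multiplier [OF \<eta> \<mu>])
  next
    fix fg
    show "- ereal \<eta> * ?P fg \<le> (SUP (u, \<nu>) \<in> {(u, \<nu>). 0 \<le> \<nu>}. ?D u \<nu>)"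
    proof (cases rule: fg_objective_cases [OF \<eta> \<mu>, of \<zeta> fg])
      case 1
      then show ?thesis using \<eta> by simp
    next
      case (2 lam \<theta>)
      then show ?thesis
        using \<eta> by (intro SUP_upper2 [of "((lam, vec \<theta>, \<theta>), 0)"]) (auto simp: D0)
    qed
  qed
  then have total: "(SUP (u, \<nu>) \<in> {(u, \<nu>). 0 \<le> \<nu>}. ?D u \<nu>) = - ereal \<eta> * (INF fg. ?P fg)"
    by (simp only: ereal_uminus_mult_INF [OF \<eta>])

  have argmin: "\<exists>c. is_arg_min ?P (\<lambda>_. True) (fg_of_multipliers \<eta> c lam \<beta>)"
    if max: "is_arg_max (\<lambda>(u, \<nu>). ?D u \<nu>) (\<lambda>(u, \<nu>). 0 \<le> \<nu>) ((lam, \<beta>, \<theta>), \<nu>)" for lam \<beta> \<theta> \<nu>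
  proof -
    have \<nu>: "0 \<le> \<nu>" using max by (simp add: is_arg_max_def)
    have le: "ereal (?V lam' (vec \<theta>') \<theta>') \<le> ?D (lam, \<beta>, \<theta>) \<nu>" for lam' \<theta>'
    proof -
      have "\<not> ?D (lam, \<beta>, \<theta>) \<nu> < ?D (lam', vec \<theta>', \<theta>') 0"
        using max by (fastforce simp: is_arg_max_def)
      then show ?thesis by (simp add: D0 not_less)
    qed
    \<comment> \<open>A single finite competitor, here with zero multipliers, excludes the value
      \<open>- \<infinity>\<close> at the maximiser.\<close>
    have \<beta>\<nu>: "\<beta> + \<nu> = vec \<theta>"
      using le [of 0 0] by (auto simp: ot_dual_eq [OF \<eta>] split: if_splits)
    \<comment> \<open>Otherwise replacing \<open>\<beta>\<close> by \<open>vec \<theta>\<close> and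
      \<open>\<nu>\<close> by \<open>0\<close> would strictly increase the dual value.\<close>
    have \<beta>: "\<beta> = vec \<theta>"
      using le [of lam \<theta>] dual_value_less [OF \<eta> \<beta>\<nu> \<nu>, of \<zeta> \<mu>s lam] \<beta>\<nu>
      by (auto simp: ot_dual_eq [OF \<eta>] not_less [symmetric])
    have V_le: "?V lam' (vec \<theta>') \<theta>' \<le> ?V lam (vec \<theta>) \<theta>" for lam' \<theta>'
      using le [of lam' \<theta>'] \<beta>\<nu> unfolding ot_dual_eq [OF \<eta>] \<beta> by simp
    have "?P (fg_of_multipliers \<eta> (1/2 - \<theta> / \<eta>) lam \<beta>) \<le> ?P fg" for fg
    proof (cases rule: fg_objective_cases [OF \<eta> \<mu>, of \<zeta> fg])
      case 1
      then show ?thesis by simp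
    next
      case (2 lam' \<theta>')
      then show ?thesis
        using \<eta> V_le [of lam' \<theta>']
        by (simp add: \<beta> fg_objective_constant_multiplier [OF \<eta> \<mu>] divide_le_cancel)
    qed
    then show ?thesis by (auto simp: is_arg_min_def not_less)
  qed

  have argmax: "\<exists>\<theta> \<nu>. is_arg_max (\<lambda>(u, \<nu>). ?D u \<nu>) (\<lambda>(u, \<nu>). 0 \<le> \<nu>) ((lam, \<beta>, \<theta>), \<nu>)"
    if min: "is_arg_min ?P (\<lambda>_. True) (fg_of_multipliers \<eta> c lam \<beta>)" for lam \<beta> c
  proof -
    define b where "b = \<eta> * (1/2 - c)"
    have le: "?P (fg_of_multipliers \<eta> c lam \<beta>) \<le> ereal (- ?V lam' (vec \<theta>) \<theta> / \<eta>)" for lam' \<theta>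
      using min fg_objective_constant_multiplier [OF \<eta> \<mu>, of \<zeta> \<theta> lam']
      by (metis is_arg_min_def not_less)
    \<comment> \<open>A finite competitor excludes the value \<open>\<infinity>\<close> at the
      minimiser, hence \<open>g = - 1\<close>, which pins \<open>\<beta>\<close> to this
      constant.\<close>
    have \<beta>: "\<beta> = vec b"
      using le [of 0 0] by (auto simp: fg_objective_multipliers [OF \<eta> \<mu>] b_def split: if_splits)
    have V_le: "?V lam' (vec \<theta>) \<theta> \<le> ?V lam (vec b) b" for lam' \<theta>
      using le [of lam' \<theta>] \<eta>
      by (simp add: fg_objective_multipliers [OF \<eta> \<mu>] \<beta> b_def divide_le_cancel)
    \<comment> \<open>The remaining multipliers are read off from \<open>c\<close>:
      \<open>\<theta> = b\<close> and \<open>\<nu> = 0\<close>.\<close>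
    have "?D u \<nu> \<le> ?D (lam, \<beta>, b) 0" if "0 \<le> \<nu>" for u \<nu>
      using D_le [OF that, of u] V_le by (metis D0 \<beta> ereal_less_eq(3) order_trans)
    then have "is_arg_max (\<lambda>(u, \<nu>). ?D u \<nu>) (\<lambda>(u, \<nu>). 0 \<le> \<nu>) ((lam, \<beta>, b), 0)"
      by (auto simp: is_arg_max_def not_less)
    then show ?thesis by blast
  qed

  show ?thesis using partial total argmin argmax by blast
qed

end
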